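(* Let $k\ge 2$, $r\ge 1$ and $\alpha$ be integers with $0\le\alpha\le rk-1$. Let $m$ be the integer with $1\le m\le k$ and $(m-1)r\le\alpha<mr$. Let $\mathcal{A}$ be a sequence of $rk$ terms which is made up of $k$ distinct integers, each repeated exactly $r$ times. If $\mathcal{A}\cap(-\mathcal{A})=\emptyset$, then $$|\Sigma_{\alpha}(\mathcal{A})|\ge r\left(\frac{k(k+1)}{2}-\frac{m(m+1)}{2}\right)+m(mr-\alpha)+1.$$ If $\mathcal{A}\cap(-\mathcal{A})=(0)_r$, then $$|\Sigma_{\alpha}(\mathcal{A})|\ge r\left(\frac{k(k-1)}{2}-\frac{m(m-1)}{2}\right)+(m-1)(mr-\alpha)+1.$$ These lower bounds are optimal, i.e. for all integers $k\ge 2$, $r\ge 1$ and $\alpha$ with $0\le\alpha\le rk-1$, and for each of the two conditions on $\mathcal{A}\cap(-\mathcal{A})$, there is a sequence $\mathcal{A}$ of $rk$ terms, made up of $k$ distinct integers each repeated exactly $r$ times, satisfying that condition for which equality holds in the corresponding bound.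
   Context: Sequences are finite and unordered (multisets): a sequence $\mathcal{A}$ made up of distinct integers $a_1,\dots,a_k$, each repeated exactly $r$ times, has $rk$ terms and is denoted $(a_1,\dots,a_k)_r$. A subsequence $\mathcal{A}'\subset\mathcal{A}$ takes each $a_i$ some number of times between $0$ and $r$; $|\mathcal{A}'|$ denotes its number of terms counted with multiplicity. For an integer $0\le\alpha\le rk$, $\Sigma_{\alpha}(\mathcal{A})=\left\{\sum_{a\in\mathcal{A}'}a : \mathcal{A}'\subset\mathcal{A},\ |\mathcal{A}'|\ge\alpha\right\}$, where sums are taken with multiplicity and the empty sum is $0$; it is a set of integers and $|\Sigma_\alpha(\mathcal{A})|$ is its cardinality. $-\mathcal{A}$ is the sequence obtained by negating every term of $\mathcal{A}$, and $\mathcal{A}\cap\mathcal{B}$ is the sequence of all terms that are in both $\mathcal{A}$ and $\mathcal{B}$. Thus $\mathcal{A}\cap(-\mathcal{A})=\emptyset$ means that there is no integer $x$ such that both $x$ and $-x$ are terms of $\mathcal{A}$ (in particular $0$ is not a term), and $\mathcal{A}\cap(-\mathcal{A})=(0)_r$ means that $0$ is a term of $\mathcal{A}$ and is the only integer $x$ such that both $x$ and $-x$ are terms of $\mathcal{A}$. *)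

theory Defs
  imports Complex_Main "HOL-Library.Multiset"
begin

definition made_up_of :: "nat \<Rightarrow> nat \<Rightarrow> int multiset \<Rightarrow> bool" where
  "made_up_of k r A \<longleftrightarrow> card (set_mset A) = k \<and> (\<forall>a \<in># A. count A a = r)"

definition Sigma_ge :: "nat \<Rightarrow> int multiset \<Rightarrow> int set" where
  "Sigma_ge \<alpha> A = {\<Sum>\<^sub># B | B. B \<subseteq># A \<and> size B \<ge> \<alpha>}"

definition neg_seq :: "int multiset \<Rightarrow> int multiset" where
  "neg_seq A = image_mset uminus A"

end

theory Submission
  imports Defs
begin

text \<open>
  Passing to complements turns sums of at least \<open>\<alpha>\<close> terms into sums of at most
  \<open>h = r k - \<alpha>\<close> terms: \<open>B \<mapsto> A - B\<close> reflects one set of sums onto the other. Zero terms do not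
  affect sums of at most \<open>h\<close> terms, so the second lower bound is the first one with \<open>k - 1\<close> and
  \<open>m - 1\<close> in place of \<open>k\<close> and \<open>m\<close>, for the same \<open>h\<close>.

  The heart of the matter is a one-step inequality (\<open>card_Sigma_le_remove_max_abs\<close>). Let no term of
  \<open>A\<close> be the negative of a term, let \<open>x\<close> be a term of largest absolute value, say \<open>x > 0\<close>, and let
  \<open>B\<close> attain the least sum \<open>\<mu>\<close> of at most \<open>h\<close> terms of \<open>A - x\<close>. Adding \<open>x\<close> to all sums of
  at most \<open>h\<close> terms of \<open>A - x\<close> gives sums of at most \<open>h + 1\<close> terms of \<open>A\<close> that are at least
  \<open>\<mu> + x\<close>. Below \<open>\<mu> + x\<close>, each distinct value \<open>y\<close> of \<open>A\<close> provides one further sum: \<open>y = x\<close>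
  provides \<open>\<mu>\<close> itself; any other \<open>y\<close> is added to \<open>B\<close> if \<open>B\<close> does not contain it, and is removed
  from \<open>B\<close> if \<open>B\<close> does. By minimality \<open>B\<close> has only negative terms, so the new sum is
  \<open>\<mu> + y\<close> or \<open>\<mu> + \<bar>y\<bar>\<close>; these sums are distinct because distinct values of \<open>A\<close> have distinct
  nonzero absolute values. Hence each removal of a term of largest absolute value costs at least
  as many sums as there are distinct values.

  Removing all \<open>r\<close> copies of the largest value, then all copies of the next one, and so on,
  until \<open>h\<close> terms are gone, gives the bound
  \<open>1 + r ((m+1) + \<dots> + k) + m s\<close> for \<open>h = (k - m) r + s\<close> with \<open>s = m r - \<alpha>\<close>.
  This is one more than the largest sum of \<open>h\<close> terms of \<open>(1, \<dots>, k)\<^sub>r\<close>, whose sums of at most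
  \<open>h\<close> terms all lie between \<open>0\<close> and that largest sum; so this sequence attains the bound, and so
  does \<open>(0, \<dots>, k-1)\<^sub>r\<close> in the second case.
\<close>

section \<open>Sums of at most a given number of terms\<close>

definition Sigma_le :: "nat \<Rightarrow> int multiset \<Rightarrow> int set" where
  "Sigma_le h A = {\<Sum>\<^sub># B | B. B \<subseteq># A \<and> size B \<le> h}"

lemma Sigma_leI: "B \<subseteq># A \<Longrightarrow> size B \<le> h \<Longrightarrow> s = \<Sum>\<^sub># B \<Longrightarrow> s \<in> Sigma_le h A"
  by (auto simp: Sigma_le_def)

lemma finite_submultisets: "finite {B. B \<subseteq># A}"
proof (induction A)
  case empty
  show ?case by simp
next
  case (add x A)
  have "{B. B \<subseteq># add_mset x A} \<subseteq> {B. B \<subseteq># A} \<union> add_mset x ` {B. B \<subseteq># A}"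
  proof
    fix B assume "B \<in> {B. B \<subseteq># add_mset x A}"
    then have B: "B \<subseteq># add_mset x A" by simp
    show "B \<in> {B. B \<subseteq># A} \<union> add_mset x ` {B. B \<subseteq># A}"
    proof (cases "x \<in># B")
      case True
      then obtain C where "B = add_mset x C" by (metis multi_member_split)
      with B show ?thesis by auto
    next
      case False
      with B have "B \<subseteq># A"
        by (metis diff_single_trivial subset_eq_diff_conv add_mset_add_single)
      then show ?thesis by simp
    qed
  qed
  then show ?case using add by (meson finite_UnI finite_imageI finite_subset)
qed

lemma finite_Sigma_le: "finite (Sigma_le h A)"
proof -
  have "Sigma_le h A \<subseteq> sum_mset ` {B. B \<subseteq># A}" by (auto simp: Sigma_le_def)
  then show ?thesis using finite_submultisets finite_surj by blast
qed

lemma Sigma_le_mono: "A \<subseteq># A' \<Longrightarrow> Sigma_le h A \<subseteq> Sigma_le h A'"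
  unfolding Sigma_le_def by (blast intro: subset_mset.order_trans)

lemma zero_in_Sigma_le: "0 \<in> Sigma_le h A"
  by (rule Sigma_leI[of "{#}"]) auto

lemma card_Sigma_le_pos: "card (Sigma_le h A) \<ge> 1"
  using zero_in_Sigma_le[of h A] finite_Sigma_le[of h A]
  by (metis One_nat_def Suc_leI card_gt_0_iff empty_iff)

lemma sum_mset_diff_int: "B \<subseteq># A \<Longrightarrow> \<Sum>\<^sub># (A - B) = \<Sum>\<^sub># A - \<Sum>\<^sub># (B :: int multiset)"
  by (metis add_diff_cancel_left' subset_mset.add_diff_inverse sum_mset.union)

text \<open>
  The complement \<open>A - B\<close> has \<open>size A - size B\<close> terms and sum \<open>\<Sum>\<^sub># A - \<Sum>\<^sub># B\<close>, so a lower
  bound on the number of terms becomes an upper bound, under a reflection of the sums.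
\<close>

lemma card_Sigma_ge_eq_card_Sigma_le:
  assumes "\<alpha> \<le> size A"
  shows "card (Sigma_ge \<alpha> A) = card (Sigma_le (size A - \<alpha>) A)"
proof -
  have "Sigma_ge \<alpha> A = (\<lambda>s. \<Sum>\<^sub># A - s) ` Sigma_le (size A - \<alpha>) A"
  proof (intro equalityI subsetI)
    fix s assume "s \<in> Sigma_ge \<alpha> A"
    then obtain B where B: "s = \<Sum>\<^sub># B" "B \<subseteq># A" "size B \<ge> \<alpha>" by (auto simp: Sigma_ge_def)
    have "\<Sum>\<^sub># (A - B) \<in> Sigma_le (size A - \<alpha>) A"
      using B by (intro Sigma_leI[of "A - B"]) (auto simp: size_Diff_submset)
    then show "s \<in> (\<lambda>s. \<Sum>\<^sub># A - s) ` Sigma_le (size A - \<alpha>) A"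
      using B by (intro image_eqI[of _ _ "\<Sum>\<^sub># (A - B)"]) (auto simp: sum_mset_diff_int)
  next
    fix s assume "s \<in> (\<lambda>s. \<Sum>\<^sub># A - s) ` Sigma_le (size A - \<alpha>) A"
    then obtain B where B: "s = \<Sum>\<^sub># A - \<Sum>\<^sub># B" "B \<subseteq># A" "size B \<le> size A - \<alpha>"
      by (auto simp: Sigma_le_def)
    then have "s = \<Sum>\<^sub># (A - B)" "A - B \<subseteq># A" "size (A - B) \<ge> \<alpha>"
      using assms by (auto simp: sum_mset_diff_int size_Diff_submset)
    then show "s \<in> Sigma_ge \<alpha> A" unfolding Sigma_ge_def by blast
  qed
  then show ?thesis by (simp add: card_image inj_on_def)
qed

lemma sum_mset_uminus: "\<Sum>\<^sub># (image_mset uminus B) = - \<Sum>\<^sub># (B :: int multiset)"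
  by (induction B) auto

lemma Sigma_le_uminus: "Sigma_le h (image_mset uminus A) = uminus ` Sigma_le h A"
proof -
  have sub: "uminus ` Sigma_le h C \<subseteq> Sigma_le h (image_mset uminus C)" for C
  proof
    fix s assume "s \<in> uminus ` Sigma_le h C"
    then obtain B where "s = - \<Sum>\<^sub># B" "B \<subseteq># C" "size B \<le> h" by (auto simp: Sigma_le_def)
    then show "s \<in> Sigma_le h (image_mset uminus C)"
      by (intro Sigma_leI[of "image_mset uminus B"])
        (auto simp: sum_mset_uminus image_mset_subseteq_mono)
  qed
  have "uminus ` uminus ` Sigma_le h (image_mset uminus A) \<subseteq> uminus ` Sigma_le h A"
    using sub[of "image_mset uminus A"] by (intro image_mono) (simp add: multiset.map_comp o_def)
  then have "Sigma_le h (image_mset uminus A) \<subseteq> uminus ` Sigma_le h A"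
    by (simp add: image_image)
  with sub[of A] show ?thesis by blast
qed

section \<open>Removing a term of largest absolute value\<close>

lemma card_Sigma_le_remove_max:
  fixes x :: int
  assumes x: "x \<in># A" "x > 0"
    and nosym: "\<And>a. a \<in># A \<Longrightarrow> - a \<notin># A"
    and max: "\<And>a. a \<in># A \<Longrightarrow> \<bar>a\<bar> \<le> x"
  shows "card (set_mset A) + card (Sigma_le h (A - {#x#})) \<le> card (Sigma_le (Suc h) A)"
proof -
  let ?S = "Sigma_le h (A - {#x#})"
  define \<mu> where "\<mu> = Min ?S"
  have "\<mu> \<in> ?S"
    unfolding \<mu>_def using finite_Sigma_le zero_in_Sigma_le by (metis Min_in empty_iff)
  then obtain B where B: "\<mu> = \<Sum>\<^sub># B" "B \<subseteq># A - {#x#}" "size B \<le> h"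
    by (auto simp: Sigma_le_def)
  have \<mu>_le: "\<mu> \<le> s" if "s \<in> ?S" for s
    unfolding \<mu>_def using that finite_Sigma_le by (meson Min_le)
  have BA: "B \<subseteq># A" using B(2) by (meson diff_subset_eq_self subset_mset.order_trans)
  have B_neg: "y < 0" if "y \<in># B" for y
  proof -
    have "B - {#y#} \<subseteq># A - {#x#}" using B(2) by (meson diff_subset_eq_self subset_mset.order_trans)
    moreover have "size (B - {#y#}) \<le> h"
      using B(3) by (meson diff_subset_eq_self le_trans size_mset_mono)
    ultimately have "\<mu> \<le> \<Sum>\<^sub># (B - {#y#})" by (intro \<mu>_le Sigma_leI[of "B - {#y#}"]) auto
    then have "y \<le> 0" using B(1) that by (simp add: sum_mset_diff_int)
    moreover have "y \<noteq> 0" using that BA nosym[of y] by (metis mset_subset_eqD neg_0_equal_iff_equal)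
    ultimately show ?thesis by simp
  qed
  \<comment> \<open>the displacement of \<open>\<mu>\<close> that the value \<open>y\<close> provides\<close>
  define d where "d y = (if y = x then 0 else if y \<in># B then - y else y)" for y
  define N where "N = (\<lambda>y. \<mu> + d y) ` set_mset A"
  have "inj_on d (set_mset A)"
  proof (rule inj_onI)
    fix y z assume yz: "y \<in># A" "z \<in># A" "d y = d z"
    have "0 \<notin># A" using nosym[of 0] by auto
    with yz have "y \<noteq> 0" "z \<noteq> 0" by auto
    moreover have "y \<noteq> - z" "- y \<noteq> z" using nosym yz by (metis minus_minus)+
    ultimately show "y = z" using yz(3) by (auto simp: d_def split: if_splits)
  qed
  then have card_N: "card N = card (set_mset A)"
    unfolding N_def by (subst card_image) (auto simp: inj_on_def)
  have d_less: "d y < x" if "y \<in># A" for y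
  proof -
    have "y \<noteq> - x" using nosym[OF x(1)] that by auto
    then show ?thesis using max[OF that] x(2) by (auto simp: d_def)
  qed
  have N_sub: "N \<subseteq> Sigma_le (Suc h) A"
  proof
    fix s assume "s \<in> N"
    then obtain y where y: "y \<in># A" "s = \<mu> + d y" by (auto simp: N_def)
    consider "y = x" | "y \<noteq> x" "y \<in># B" | "y \<noteq> x" "y \<notin># B" by blast
    then show "s \<in> Sigma_le (Suc h) A"
    proof cases
      case 1
      then show ?thesis using B BA y by (intro Sigma_leI[of B]) (auto simp: d_def)
    next
      case 2
      moreover have "size (B - {#y#}) \<le> Suc h"
        using B(3) by (meson diff_subset_eq_self le_trans le_SucI size_mset_mono)
      ultimately show ?thesis using B BA y
        by (intro Sigma_leI[of "B - {#y#}"])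
          (auto simp: d_def sum_mset_diff_int intro: subset_mset.order_trans[of _ B])
    next
      case 3
      have "add_mset y B \<subseteq># A"
        using 3 BA y(1) by (auto simp: subseteq_mset_def not_in_iff)
      then show ?thesis using 3 B y
        by (intro Sigma_leI[of "add_mset y B"]) (auto simp: d_def)
    qed
  qed
  have shift_sub: "(+) x ` ?S \<subseteq> Sigma_le (Suc h) A"
  proof
    fix s assume "s \<in> (+) x ` ?S"
    then obtain C where C: "s = x + \<Sum>\<^sub># C" "C \<subseteq># A - {#x#}" "size C \<le> h"
      by (auto simp: Sigma_le_def)
    then have "add_mset x C \<subseteq># A" using x(1) by (simp add: insert_subset_eq_iff)
    then show "s \<in> Sigma_le (Suc h) A" using C by (intro Sigma_leI[of "add_mset x C"]) auto
  qed
  have disj: "N \<inter> (+) x ` ?S = {}"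
  proof -
    have "s < t" if "s \<in> N" "t \<in> (+) x ` ?S" for s t
      using that d_less \<mu>_le unfolding N_def by fastforce
    then show ?thesis by blast
  qed
  have "card (set_mset A) + card ?S = card N + card ((+) x ` ?S)"
    by (simp add: card_N card_image)
  also have "\<dots> = card (N \<union> (+) x ` ?S)"
    using disj finite_Sigma_le by (intro card_Un_disjoint[symmetric]) (auto simp: N_def)
  also have "\<dots> \<le> card (Sigma_le (Suc h) A)"
    using N_sub shift_sub finite_Sigma_le by (intro card_mono) auto
  finally show ?thesis .
qed

text \<open>Negating all terms reflects the set of sums, so the sign of the extreme term is irrelevant.\<close>

lemma card_Sigma_le_remove_max_abs:
  fixes x :: int
  assumes x: "x \<in># A"
    and nosym: "\<And>a. a \<in># A \<Longrightarrow> - a \<notin># A"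
    and max: "\<And>a. a \<in># A \<Longrightarrow> \<bar>a\<bar> \<le> \<bar>x\<bar>"
  shows "card (set_mset A) + card (Sigma_le h (A - {#x#})) \<le> card (Sigma_le (Suc h) A)"
proof (cases "x > 0")
  case True
  then show ?thesis using assms by (intro card_Sigma_le_remove_max) auto
next
  case False
  have "x \<noteq> 0" using nosym[OF x] x by auto
  let ?A = "image_mset uminus A"
  have "card (set_mset ?A) + card (Sigma_le h (?A - {#- x#})) \<le> card (Sigma_le (Suc h) ?A)"
    using False \<open>x \<noteq> 0\<close> assms by (intro card_Sigma_le_remove_max) force+
  moreover have "?A - {#- x#} = image_mset uminus (A - {#x#})"
    using x by (simp add: image_mset_Diff)
  ultimately show ?thesis
    by (simp add: Sigma_le_uminus card_image)
qed

lemma card_Sigma_le_remove_copies: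
  fixes x :: int
  assumes "x \<in># A"
    and "\<And>a. a \<in># A \<Longrightarrow> - a \<notin># A"
    and "\<And>a. a \<in># A \<Longrightarrow> \<bar>a\<bar> \<le> \<bar>x\<bar>"
    and "t \<le> count A x"
  shows "t * card (set_mset A) + card (Sigma_le h (A - replicate_mset t x))
           \<le> card (Sigma_le (h + t) A)"
  using assms(4)
proof (induction t arbitrary: h)
  case 0
  then show ?case by simp
next
  case (Suc t)
  let ?A = "A - replicate_mset t x"
  \<comment> \<open>the last copy of \<open>x\<close> is still present before each removal, so no value has been lost\<close>
  have "\<And>a. a \<in># ?A \<longleftrightarrow> a \<in># A"
    using Suc.prems assms(1) by (auto simp: in_diff_count)
  then have set: "set_mset ?A = set_mset A" by blast
  have "card (set_mset ?A) + card (Sigma_le h (?A - {#x#})) \<le> card (Sigma_le (Suc h) ?A)"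
    using assms(1-3) unfolding set[symmetric] by (intro card_Sigma_le_remove_max_abs) auto
  moreover have "?A - {#x#} = A - replicate_mset (Suc t) x" by simp
  moreover have "t * card (set_mset A) + card (Sigma_le (Suc h) ?A) \<le> card (Sigma_le (Suc h + t) A)"
    using Suc.prems by (intro Suc.IH) simp
  ultimately show ?case using set by simp
qed

section \<open>The lower bound for repeated values\<close>

lemma ex_max_abs:
  fixes A :: "int multiset"
  assumes "A \<noteq> {#}"
  obtains x where "x \<in># A" "\<And>a. a \<in># A \<Longrightarrow> \<bar>a\<bar> \<le> \<bar>x\<bar>"
proof -
  obtain x where "x \<in> set_mset A" "\<not> (\<exists>y\<in>set_mset A. \<bar>x\<bar> < \<bar>y\<bar>)"
    using assms arg_min_if_finite(1,2)[of "set_mset A" "\<lambda>a. - \<bar>a\<bar>"] by auto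
  then show ?thesis by (intro that) force+
qed

text \<open>
  The sum \<open>\<Sum>{m<..k}\<close> collects the numbers of distinct values that are present while the values
  of largest absolute value are removed completely, one after the other; the term \<open>m * s\<close> comes
  from the \<open>s\<close> copies of the next value, removed while \<open>m\<close> values are present.
\<close>

lemma card_Sigma_le_lower_bound:
  assumes "m \<le> k" "made_up_of k r A" "s \<le> r" "\<And>a. a \<in># A \<Longrightarrow> - a \<notin># A"
  shows "r * \<Sum>{m<..k} + m * s + 1 \<le> card (Sigma_le ((k - m) * r + s) A)"
  using assms
proof (induction k arbitrary: A rule: dec_induct)
  case base
  show ?case
  proof (cases "A = {#}")
    case True
    then have "m = 0" using base by (simp add: made_up_of_def)
    then show ?thesis using card_Sigma_le_pos[of s A] by simp
  next
    case False
    then obtain x where x: "x \<in># A" "\<And>a. a \<in># A \<Longrightarrow> \<bar>a\<bar> \<le> \<bar>x\<bar>" using ex_max_abs by blast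
    then have "s * m + card (Sigma_le 0 (A - replicate_mset s x)) \<le> card (Sigma_le (0 + s) A)"
      using base card_Sigma_le_remove_copies[of x A s 0] by (auto simp: made_up_of_def)
    then show ?thesis
      using card_Sigma_le_pos[of 0 "A - replicate_mset s x"] by (simp add: mult.commute)
  qed
next
  case (step k)
  define h where "h = (k - m) * r + s"
  have "A \<noteq> {#}" using step.prems by (auto simp: made_up_of_def)
  then obtain x where x: "x \<in># A" "\<And>a. a \<in># A \<Longrightarrow> \<bar>a\<bar> \<le> \<bar>x\<bar>" using ex_max_abs by blast
  let ?A = "A - replicate_mset r x"
  have count: "count ?A a = (if a = x then 0 else count A a)" for a
    using step.prems x by (auto simp: made_up_of_def)
  have "\<And>a. a \<in># ?A \<longleftrightarrow> a \<in># A \<and> a \<noteq> x"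
    using count by (metis count_eq_zero_iff)
  then have set: "set_mset ?A = set_mset A - {x}" by auto
  have "made_up_of k r ?A"
    using step.prems x unfolding made_up_of_def set by (auto simp: count)
  then have "r * \<Sum>{m<..k} + m * s + 1 \<le> card (Sigma_le h ?A)"
    unfolding h_def using step.prems set by (intro step.IH) auto
  moreover have "r * Suc k + card (Sigma_le h ?A) \<le> card (Sigma_le (h + r) A)"
    using step.prems x card_Sigma_le_remove_copies[of x A r h] by (auto simp: made_up_of_def)
  moreover have "(Suc k - m) * r + s = h + r" using step.hyps by (simp add: h_def Suc_diff_le)
  moreover have "\<Sum>{m<..Suc k} = Suc k + \<Sum>{m<..k}"
  proof -
    have "{m<..Suc k} = insert (Suc k) {m<..k}" using step.hyps by auto
    then show ?thesis by simp
  qed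
  ultimately show ?case by (simp add: distrib_left)
qed

section \<open>Intervals of integers\<close>

definition interval_seq :: "nat \<Rightarrow> nat \<Rightarrow> nat \<Rightarrow> int multiset" where
  "interval_seq r c n = repeat_mset r (mset_set (int ` {c..n}))"

lemma count_interval_seq: "count (interval_seq r c n) a = (if a \<in> int ` {c..n} then r else 0)"
  by (simp add: interval_seq_def)

lemma set_mset_interval_seq: "r \<ge> 1 \<Longrightarrow> set_mset (interval_seq r c n) = int ` {c..n}"
  by (auto simp: set_mset_def count_interval_seq)

lemma made_up_of_interval_seq: "r \<ge> 1 \<Longrightarrow> made_up_of (Suc n - c) r (interval_seq r c n)"
  by (auto simp: made_up_of_def set_mset_interval_seq count_interval_seq card_image)

lemma sum_mset_interval_seq:
  fixes f :: "int \<Rightarrow> int"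
  shows "(\<Sum>a\<in>#interval_seq r c n. f a) = int r * (\<Sum>j = c..n. f (int j))"
proof -
  have "(\<Sum>a\<in>#repeat_mset r M. f a) = int r * (\<Sum>a\<in>#M. f a)" for M
    by (induction r) (auto simp: algebra_simps)
  moreover have "(\<Sum>a\<in>#mset_set (int ` {c..n}). f a) = (\<Sum>j = c..n. f (int j))"
    by (simp add: sum_unfold_sum_mset[symmetric] sum.reindex)
  ultimately show ?thesis by (simp add: interval_seq_def)
qed

text \<open>
  When \<open>s \<le> r\<close>, the bound is the sum of all copies of the values above \<open>p\<close> and \<open>s\<close> copies of
  \<open>p\<close>. It holds because each term \<open>b\<close> is at most
  \<open>p + max 0 (b - p)\<close>: the number of terms controls the first part and the multiplicity \<open>r\<close> the second one.
\<close>

lemma sum_le_of_subset_interval_seq: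
  assumes "c \<le> Suc p" "p \<le> n" "B \<subseteq># interval_seq r c n" "size B \<le> (n - p) * r + s"
  shows "\<Sum>\<^sub># B \<le> int (r * \<Sum>{p<..n} + p * s)"
proof -
  let ?f = "\<lambda>b. max 0 (b - int p)"
  have "\<Sum>\<^sub># B \<le> (\<Sum>b\<in>#B. int p + ?f b)"
    using sum_mset_mono[of B "\<lambda>b. b" "\<lambda>b. int p + ?f b"] by force
  also have "\<dots> = int p * int (size B) + (\<Sum>b\<in>#B. ?f b)"
    by (simp add: sum_mset.distrib)
  also have "\<dots> \<le> int p * int ((n - p) * r + s) + (\<Sum>b\<in>#interval_seq r c n. ?f b)"
  proof (rule add_mono)
    show "int p * int (size B) \<le> int p * int ((n - p) * r + s)"
      using assms(4) by (intro mult_left_mono) (simp_all only: of_nat_le_iff of_nat_0_le_iff)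
    obtain C where C: "interval_seq r c n = B + C"
      using assms(3) by (auto simp: subset_mset.le_iff_add)
    have "(\<Sum>b\<in>#C. ?f b) \<ge> 0" by (induction C) auto
    then show "(\<Sum>b\<in>#B. ?f b) \<le> (\<Sum>b\<in>#interval_seq r c n. ?f b)" by (simp add: C)
  qed
  also have "(\<Sum>b\<in>#interval_seq r c n. ?f b) = int r * (\<Sum>j = c..n. ?f (int j))"
    by (rule sum_mset_interval_seq)
  also have "(\<Sum>j = c..n. ?f (int j)) = (\<Sum>j\<in>{p<..n}. int j - int p)"
    using assms(1) by (intro sum.mono_neutral_cong_right) auto
  also have "\<dots> = int (\<Sum>{p<..n}) - int (n - p) * int p"
    by (simp add: sum_subtractf)
  finally show ?thesis by (simp add: distrib_left right_diff_distrib mult.left_commute mult.commute)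
qed

lemma card_Sigma_le_interval_seq_upper_bound:
  assumes "c \<le> Suc p" "p \<le> n"
  shows "card (Sigma_le ((n - p) * r + s) (interval_seq r c n)) \<le> r * \<Sum>{p<..n} + p * s + 1"
proof -
  let ?M = "r * \<Sum>{p<..n} + p * s"
  have "Sigma_le ((n - p) * r + s) (interval_seq r c n) \<subseteq> {0..int ?M}"
  proof
    fix t assume "t \<in> Sigma_le ((n - p) * r + s) (interval_seq r c n)"
    then obtain B where B: "t = \<Sum>\<^sub># B" "B \<subseteq># interval_seq r c n" "size B \<le> (n - p) * r + s"
      by (auto simp: Sigma_le_def)
    have "b \<ge> 0" if "b \<in># B" for b
    proof -
      have "count (interval_seq r c n) b > 0"
        using that B(2) by (meson count_greater_zero_iff mset_subset_eqD)
      then show ?thesis by (auto simp: count_interval_seq split: if_splits)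
    qed
    then have "\<Sum>\<^sub># B \<ge> 0" by (induction B) auto
    then show "t \<in> {0..int ?M}"
      using sum_le_of_subset_interval_seq[OF assms B(2,3)] B(1) by simp
  qed
  then have "card (Sigma_le ((n - p) * r + s) (interval_seq r c n)) \<le> card {0..int ?M}"
    by (intro card_mono) auto
  also have "card {0..int ?M} = ?M + 1"
    by (subst card_atLeastAtMost_int) linarith
  finally show ?thesis .
qed

section \<open>Sums of at least a given number of terms\<close>

lemma real_sum_greaterThanAtMost:
  assumes "m \<le> k"
  shows "real (\<Sum>{m<..k}) = real k * (real k + 1) / 2 - real m * (real m + 1) / 2"
  using assms
proof (induction k rule: dec_induct)
  case base
  then show ?case by simp
next
  case (step k)
  have "{m<..Suc k} = insert (Suc k) {m<..k}" using step.hyps by auto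
  then show ?case using step.IH by (simp add: field_simps)
qed

lemma size_made_up_of:
  assumes "made_up_of k r A"
  shows "size A = r * k"
  using assms by (simp add: made_up_of_def size_multiset_overloaded_eq)

lemma count_neg_seq: "count (neg_seq A) x = count A (- x)"
  by (induction A) (auto simp: neg_seq_def)

lemma inter_neg_seq_empty_iff: "A \<inter># neg_seq A = {#} \<longleftrightarrow> (\<forall>a \<in># A. - a \<notin># A)"
proof -
  have "A \<inter># neg_seq A = {#} \<longleftrightarrow> (\<forall>x. min (count A x) (count A (- x)) = 0)"
    by (simp add: multiset_eq_iff count_neg_seq)
  also have "\<dots> \<longleftrightarrow> (\<forall>a \<in># A. - a \<notin># A)"
    by (metis count_eq_zero_iff min_0L min_0R min_def)
  finally show ?thesis .
qed

theorem theorem6: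
  fixes k r \<alpha> m :: nat
  assumes "k \<ge> 2" and "r \<ge> 1" and "\<alpha> \<le> r * k - 1"
    and "1 \<le> m" and "m \<le> k" and "(m - 1) * r \<le> \<alpha>" and "\<alpha> < m * r"
  shows "(\<forall>A. made_up_of k r A \<and> A \<inter># neg_seq A = {#} \<longrightarrow>
            real (card (Sigma_ge \<alpha> A)) \<ge>
              real r * (real k * (real k + 1) / 2 - real m * (real m + 1) / 2)
                + real m * (real m * real r - real \<alpha>) + 1)
       \<and> (\<forall>A. made_up_of k r A \<and> A \<inter># neg_seq A = replicate_mset r 0 \<longrightarrow>
            real (card (Sigma_ge \<alpha> A)) \<ge>
              real r * (real k * (real k - 1) / 2 - real m * (real m - 1) / 2)
                + (real m - 1) * (real m * real r - real \<alpha>) + 1)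
       \<and> (\<exists>A. made_up_of k r A \<and> A \<inter># neg_seq A = {#} \<and>
            real (card (Sigma_ge \<alpha> A)) =
              real r * (real k * (real k + 1) / 2 - real m * (real m + 1) / 2)
                + real m * (real m * real r - real \<alpha>) + 1)
       \<and> (\<exists>A. made_up_of k r A \<and> A \<inter># neg_seq A = replicate_mset r 0 \<and>
            real (card (Sigma_ge \<alpha> A)) =
              real r * (real k * (real k - 1) / 2 - real m * (real m - 1) / 2)
                + (real m - 1) * (real m * real r - real \<alpha>) + 1)"
proof -
  define s where "s = m * r - \<alpha>"
  define h where "h = (k - m) * r + s"
  have s: "s \<le> r" "real s = real m * real r - real \<alpha>"
  proof -
    have "m * r = (m - 1) * r + r" using assms(4) by (simp add: mult_eq_if)
    then show "s \<le> r" using assms(6) by (simp add: s_def)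
    show "real s = real m * real r - real \<alpha>" using assms(7) by (simp add: s_def of_nat_diff)
  qed
  have "m * r \<le> r * k" using assms(5) by (simp add: mult.commute)
  moreover have "(k - m) * r = r * k - m * r" by (simp only: diff_mult_distrib mult.commute[of r])
  ultimately have \<alpha>: "\<alpha> \<le> r * k" "r * k - \<alpha> = h"
    using assms(7) unfolding h_def s_def by linarith+
  have card_ge: "card (Sigma_ge \<alpha> A) = card (Sigma_le h A)" if "made_up_of k r A" for A
    using card_Sigma_ge_eq_card_Sigma_le[of \<alpha> A] that \<alpha> by (simp add: size_made_up_of)
  \<comment> \<open>dropping the value \<open>0\<close> lowers \<open>k\<close> and \<open>m\<close> by one, so the same \<open>h\<close> and \<open>s\<close> serve\<close>
  have h': "h = ((k - 1) - (m - 1)) * r + s" using assms(4,5) by (simp add: h_def)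
  have bound1: "real (r * \<Sum>{m<..k} + m * s + 1) =
      real r * (real k * (real k + 1) / 2 - real m * (real m + 1) / 2)
        + real m * (real m * real r - real \<alpha>) + 1" (is "_ = ?b1")
    using real_sum_greaterThanAtMost[OF assms(5)] s(2) by simp
  have bound2: "real (r * \<Sum>{m - 1<..k - 1} + (m - 1) * s + 1) =
      real r * (real k * (real k - 1) / 2 - real m * (real m - 1) / 2)
        + (real m - 1) * (real m * real r - real \<alpha>) + 1" (is "_ = ?b2")
  proof -
    have "real (\<Sum>{m - 1<..k - 1}) = real k * (real k - 1) / 2 - real m * (real m - 1) / 2"
      using real_sum_greaterThanAtMost[of "m - 1" "k - 1"] assms(4,5)
      by (simp add: of_nat_diff mult.commute)
    then show ?thesis using s(2) assms(4) by (simp add: of_nat_diff)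
  qed
  have lower1: "real (card (Sigma_ge \<alpha> A)) \<ge> ?b1"
    if A: "made_up_of k r A" "A \<inter># neg_seq A = {#}" for A
  proof -
    have "r * \<Sum>{m<..k} + m * s + 1 \<le> card (Sigma_le h A)"
      unfolding h_def using A s(1) assms(5)
      by (intro card_Sigma_le_lower_bound) (auto simp: inter_neg_seq_empty_iff)
    then show ?thesis unfolding bound1[symmetric] card_ge[OF A(1)] by (rule of_nat_mono)
  qed
  have lower2: "real (card (Sigma_ge \<alpha> A)) \<ge> ?b2"
    if A: "made_up_of k r A" "A \<inter># neg_seq A = replicate_mset r 0" for A
  proof -
    let ?A = "filter_mset (\<lambda>a. a \<noteq> 0) A"
    have inter: "min (count A x) (count A (- x)) = (if x = 0 then r else 0)" for x
      using arg_cong[OF A(2), of "\<lambda>M. count M x"] by (auto simp: count_neg_seq)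
    have "count A 0 = r" using inter[of 0] by simp
    then have "0 \<in># A" using assms(2) by (metis count_eq_zero_iff not_one_le_zero)
    moreover have "set_mset ?A = set_mset A - {0}" by auto
    ultimately have "made_up_of (k - 1) r ?A" using A(1) by (auto simp: made_up_of_def)
    moreover have "- a \<notin># ?A" if "a \<in># ?A" for a
    proof -
      have "count A a > 0" using that by simp
      moreover have "min (count A a) (count A (- a)) = 0" using inter[of a] that by simp
      ultimately have "count A (- a) = 0" by linarith
      then show ?thesis by (simp add: not_in_iff)
    qed
    ultimately have "r * \<Sum>{m - 1<..k - 1} + (m - 1) * s + 1 \<le> card (Sigma_le h ?A)"
      unfolding h' using s(1) assms(5) by (intro card_Sigma_le_lower_bound) auto
    also have "\<dots> \<le> card (Sigma_le h A)"
      by (intro card_mono finite_Sigma_le Sigma_le_mono) simp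
    finally show ?thesis unfolding bound2[symmetric] card_ge[OF A(1)] by (rule of_nat_mono)
  qed
  have sharp1: "\<exists>A. made_up_of k r A \<and> A \<inter># neg_seq A = {#} \<and> real (card (Sigma_ge \<alpha> A)) = ?b1"
  proof (intro exI conjI)
    let ?A = "interval_seq r 1 k"
    show A: "made_up_of k r ?A" using made_up_of_interval_seq[OF assms(2), of k 1] by simp
    show A': "?A \<inter># neg_seq ?A = {#}"
      using assms(2) by (auto simp: inter_neg_seq_empty_iff set_mset_interval_seq)
    have "card (Sigma_le h ?A) \<le> r * \<Sum>{m<..k} + m * s + 1"
      unfolding h_def using assms(5) by (intro card_Sigma_le_interval_seq_upper_bound) auto
    then have "real (card (Sigma_ge \<alpha> ?A)) \<le> ?b1"
      unfolding bound1[symmetric] card_ge[OF A] by (rule of_nat_mono)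
    with lower1[OF A A'] show "real (card (Sigma_ge \<alpha> ?A)) = ?b1" by (rule antisym[rotated])
  qed
  have sharp2: "\<exists>A. made_up_of k r A \<and> A \<inter># neg_seq A = replicate_mset r 0
      \<and> real (card (Sigma_ge \<alpha> A)) = ?b2"
  proof (intro exI conjI)
    let ?A = "interval_seq r 0 (k - 1)"
    show A: "made_up_of k r ?A"
      using made_up_of_interval_seq[OF assms(2), of "k - 1" 0] assms(1) by simp
    show A': "?A \<inter># neg_seq ?A = replicate_mset r 0"
      by (rule multiset_eqI) (auto simp: count_neg_seq count_interval_seq)
    have "card (Sigma_le h ?A) \<le> r * \<Sum>{m - 1<..k - 1} + (m - 1) * s + 1"
      unfolding h' using assms(5) by (intro card_Sigma_le_interval_seq_upper_bound) auto
    then have "real (card (Sigma_ge \<alpha> ?A)) \<le> ?b2"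
      unfolding bound2[symmetric] card_ge[OF A] by (rule of_nat_mono)
    with lower2[OF A A'] show "real (card (Sigma_ge \<alpha> ?A)) = ?b2" by (rule antisym[rotated])
  qed
  from lower1 lower2 sharp1 sharp2 show ?thesis by blast
qed

end
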